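(* Let $K$ be a field, let $(\mathfrak{L},[,],\omega)$ be a symplectic Leibniz algebra over $K$ and let $r=r^1\otimes r^2\in\mathfrak{L}\otimes\mathfrak{L}$. Suppose that $(\mathfrak{L},[,],r,\delta_r)$ is a triangular Leibniz bialgebra, where $$\delta_r(x)=-r^{1}\otimes [r^{2}, x]+[r^{2}, x]\otimes r^{1}+[x, r^{2}]\otimes r^{1},$$ and that $(\mathfrak{L},\delta_r,\omega,[,]_\omega)$ is a dual triangular Leibniz bialgebra, where, writing $\delta_r(x)=x_{(1)}\otimes x_{(2)}$, $$[x,y]_\omega=-\omega(x,y_{(1)})y_{(2)}+\omega(y,x_{(1)})x_{(2)}+x_{(1)}\omega(y,x_{(2)}).$$ Define a linear map $N:\mathfrak{L}\to\mathfrak{L}$ by $N(x)=\omega(x,r^1)r^2$ for all $x\in\mathfrak{L}$. Then $(\mathfrak{L},[,],N)$ is a Nijenhuis Leibniz algebra.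
   Context: All vector spaces, tensor products and linear maps are over a fixed field $K$; summation is understood in $r=r^1\otimes r^2$ (with $\bar r=\bar r^1\otimes\bar r^2$ a second copy of $r$) and in Sweedler notation $\delta(x)=x_{(1)}\otimes x_{(2)}$. A (left) Leibniz algebra $(\mathfrak{L},[,])$: bilinear bracket with $[x,[y,z]]=[[x,y],z]+[y,[x,z]]$ for all $x,y,z$. A Leibniz coalgebra $(\mathfrak{L},\delta)$: linear $\delta:\mathfrak{L}\to\mathfrak{L}\otimes\mathfrak{L}$ with $x_{(1)}\otimes x_{(2)(1)}\otimes x_{(2)(2)}=x_{(1)(1)}\otimes x_{(1)(2)}\otimes x_{(2)}+x_{(2)(1)}\otimes x_{(1)}\otimes x_{(2)(2)}$ for all $x$. A Leibniz bialgebra $(\mathfrak{L},[,],\delta)$: a Leibniz algebra and a Leibniz coalgebra such that for all $x,y$: $0=x_{(2)}\otimes [x_{(1)}, y]-[y_{(1)}, x]\otimes y_{(2)}$ and $\delta([x,y])=x_{(1)}\otimes [x_{(2)}, y]-[y, x_{(1)}]\otimes x_{(2)}-[x_{(1)}, y]\otimes x_{(2)}+x_{(2)}\otimes [x_{(1)}, y]-[y, x_{(2)}]\otimes x_{(1)}-[x_{(2)}, y]\otimes x_{(1)}+[x, y_{(1)}]\otimes y_{(2)}+y_{(1)}\otimes [x, y_{(2)}]$. Triangular: $(\mathfrak{L},[,],r,\delta_r)$ is a triangular Leibniz bialgebra if $(\mathfrak{L},[,])$ is a Leibniz algebra and $r$ is symmetric ($r^1\otimes r^2=r^2\otimes r^1$)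 and solves the classical Leibniz Yang-Baxter equation in $(\mathfrak{L},[,])$: $$r^1\otimes[r^2,\bar r^1]\otimes\bar r^2+r^1\otimes\bar r^1\otimes[r^2,\bar r^2]=[r^2,\bar r^1]\otimes r^1\otimes\bar r^2+[r^1,\bar r^2]\otimes\bar r^1\otimes r^2$$ (it is known that then $(\mathfrak{L},[,],\delta_r)$ is a Leibniz bialgebra). Dual triangular: $(\mathfrak{L},\delta,\omega,[,]_\omega)$ is a dual triangular Leibniz bialgebra if $(\mathfrak{L},\delta)$ is a Leibniz coalgebra and $\omega\in(\mathfrak{L}\otimes\mathfrak{L})^*$ is a bilinear form that is symmetric ($\omega(x,y)=\omega(y,x)$) and solves the co-classical Leibniz Yang-Baxter equation in $(\mathfrak{L},\delta)$: for all $x,y,z$, $$\omega(x,y_{(1)})\omega(y_{(2)},z)+\omega(x,z_{(1)})\omega(y,z_{(2)})=\omega(y,x_{(1)})\omega(x_{(2)},z)+\omega(x_{(1)},z)\omega(y,x_{(2)})$$ (then $(\mathfrak{L},[,]_\omega,\delta)$ is a Leibniz bialgebra). Symplectic Leibniz algebra $(\mathfrak{L},[,],\omega)$: a Leibniz algebra with a symmetric bilinear form $\omega$ satisfying $\omega([x,y],z)+\omega([x,z],y)=\omega([y,z],x)+\omega([z,y],x)$ for all $x,y,z$. Nijenhuis Leibniz algebra $(\mathfrak{L},[,],N)$: a Leibniz algebra with a linear map $N:\mathfrak{L}\to\mathfrak{L}$ satisfying $[N(x),N(y)]+N^2([x,y])=N([N(x),y])+N([x,N(y)])$ for all $x,y$.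 *)

theory Defs
  imports Complex_Main "HOL-Library.Poly_Mapping"
begin

section \<open>Tensor powers of a vector space\<close>

text \<open>
  Throughout, \<open>scale\<close> is the scalar multiplication of a vector space, as in
  \<^locale>\<open>vector_space\<close>. The spaces \<open>L \<otimes> L\<close> and \<open>L \<otimes> L \<otimes> L\<close> are the standard quotients: the free
  vector space on \<open>L \<times> L\<close> (resp. \<open>L \<times> L \<times> L\<close>), realised as finitely supported functions, modulo
  the span of the multilinearity relations. Since the relations depend on the scalar
  multiplication, a tensor is a coset in the free space, and the tensor product is a
  set of cosets, not a type.
\<close>

definition free_scale :: "'k::field \<Rightarrow> ('b \<Rightarrow>\<^sub>0 'k) \<Rightarrow> ('b \<Rightarrow>\<^sub>0 'k)"
  where "free_scale c p = Poly_Mapping.map (\<lambda>d. c * d) p"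

definition pure2 :: "'v \<Rightarrow> 'v \<Rightarrow> ('v \<times> 'v \<Rightarrow>\<^sub>0 'k::field)"
  where "pure2 u v = Poly_Mapping.single (u, v) 1"

definition pure3 :: "'v \<Rightarrow> 'v \<Rightarrow> 'v \<Rightarrow> ('v \<times> 'v \<times> 'v \<Rightarrow>\<^sub>0 'k::field)"
  where "pure3 u v w = Poly_Mapping.single (u, v, w) 1"

definition rels2 :: "('k::field \<Rightarrow> 'v::ab_group_add \<Rightarrow> 'v) \<Rightarrow> ('v \<times> 'v \<Rightarrow>\<^sub>0 'k) set"
  where "rels2 scale = module.span free_scale
    ({pure2 (u + u') v - pure2 u v - pure2 u' v | u u' v. True} \<union>
     {pure2 u (v + v') - pure2 u v - pure2 u v' | u v v'. True} \<union>
     {pure2 (scale c u) v - free_scale c (pure2 u v) | c u v. True} \<union>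
     {pure2 u (scale c v) - free_scale c (pure2 u v) | c u v. True})"

definition rels3 :: "('k::field \<Rightarrow> 'v::ab_group_add \<Rightarrow> 'v) \<Rightarrow> ('v \<times> 'v \<times> 'v \<Rightarrow>\<^sub>0 'k) set"
  where "rels3 scale = module.span free_scale
    ({pure3 (u + u') v w - pure3 u v w - pure3 u' v w | u u' v w. True} \<union>
     {pure3 u (v + v') w - pure3 u v w - pure3 u v' w | u v v' w. True} \<union>
     {pure3 u v (w + w') - pure3 u v w - pure3 u v w' | u v w w'. True} \<union>
     {pure3 (scale c u) v w - free_scale c (pure3 u v w) | c u v w. True} \<union>
     {pure3 u (scale c v) w - free_scale c (pure3 u v w) | c u v w. True} \<union>
     {pure3 u v (scale c w) - free_scale c (pure3 u v w) | c u v w. True})"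

definition class2 ::
    "('k::field \<Rightarrow> 'v::ab_group_add \<Rightarrow> 'v) \<Rightarrow> ('v \<times> 'v \<Rightarrow>\<^sub>0 'k) \<Rightarrow> ('v \<times> 'v \<Rightarrow>\<^sub>0 'k) set"
  where "class2 scale p = {q. q - p \<in> rels2 scale}"

definition class3 ::
    "('k::field \<Rightarrow> 'v::ab_group_add \<Rightarrow> 'v) \<Rightarrow> ('v \<times> 'v \<times> 'v \<Rightarrow>\<^sub>0 'k) \<Rightarrow> ('v \<times> 'v \<times> 'v \<Rightarrow>\<^sub>0 'k) set"
  where "class3 scale p = {q. q - p \<in> rels3 scale}"

definition tensor2 :: "('k::field \<Rightarrow> 'v::ab_group_add \<Rightarrow> 'v) \<Rightarrow> ('v \<times> 'v \<Rightarrow>\<^sub>0 'k) set set"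
  where "tensor2 scale = range (class2 scale)"

text \<open>
  Sweedler notation. \<open>linear_extension sW f\<close> extends \<open>f\<close> from the basis to the free vector space.
  For \<open>T = t\<^sup>1 \<otimes> t\<^sup>2\<close> (summation understood), \<open>sweedler sW (\<lambda>(a, b). f a b) T\<close> is the sum
  \<open>f t\<^sup>1 t\<^sup>2\<close> with values in a vector space with scalar multiplication \<open>sW\<close>, taken over some
  expression of \<open>T\<close> as a sum of pure tensors. By \<open>sweedler_class2\<close> below, its value is independent
  of that expression when \<open>f\<close> is bilinear. Tensor-valued sums are formed in the free space
  (\<open>sW = free_scale\<close>) and then sent to their class; here \<open>f\<close> is bilinear modulo the relations
  only, and \<open>sweedler_class2_mod\<close> applies.
\<close>

definition linear_extension ::
    "('k::field \<Rightarrow> 'w::ab_group_add \<Rightarrow> 'w) \<Rightarrow> ('b \<Rightarrow> 'w) \<Rightarrow> ('b \<Rightarrow>\<^sub>0 'k) \<Rightarrow> 'w"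
  where "linear_extension sW f p =
    (\<Sum>i\<in>Poly_Mapping.keys p. sW (Poly_Mapping.lookup p i) (f i))"

definition sweedler ::
    "('k::field \<Rightarrow> 'w::ab_group_add \<Rightarrow> 'w) \<Rightarrow> ('v \<times> 'v \<Rightarrow> 'w) \<Rightarrow> ('v \<times> 'v \<Rightarrow>\<^sub>0 'k) set \<Rightarrow> 'w"
  where "sweedler sW f T = linear_extension sW f (SOME p. p \<in> T)"

lemma lookup_free_scale:
  "Poly_Mapping.lookup (free_scale c p) i = c * Poly_Mapping.lookup p i"
  by (simp add: free_scale_def Poly_Mapping.map.rep_eq when_def)

lemma vector_space_free_scale:
  "vector_space (free_scale :: 'k::field \<Rightarrow> ('b \<Rightarrow>\<^sub>0 'k) \<Rightarrow> _)"
  by unfold_locales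
    (simp_all add: poly_mapping_eq_iff fun_eq_iff lookup_free_scale lookup_add algebra_simps)

lemma linear_linear_extension:
  fixes sW :: "'k::field \<Rightarrow> 'w::ab_group_add \<Rightarrow> 'w" and f :: "'b \<Rightarrow> 'w"
  assumes "vector_space sW"
  shows "Vector_Spaces.linear free_scale sW (linear_extension sW f)"
proof -
  interpret W: vector_space sW by fact
  interpret F: vector_space "free_scale :: 'k \<Rightarrow> ('b \<Rightarrow>\<^sub>0 'k) \<Rightarrow> _"
    by (rule vector_space_free_scale)
  have sup: "linear_extension sW f p = (\<Sum>i\<in>A. sW (Poly_Mapping.lookup p i) (f i))"
    if "finite A" "Poly_Mapping.keys p \<subseteq> A" for p :: "'b \<Rightarrow>\<^sub>0 'k" and A
    unfolding linear_extension_def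
    by (rule sum.mono_neutral_left) (use that in \<open>auto simp: in_keys_iff\<close>)
  show ?thesis
  proof unfold_locales
    fix p q :: "'b \<Rightarrow>\<^sub>0 'k"
    let ?A = "Poly_Mapping.keys p \<union> Poly_Mapping.keys q"
    show "linear_extension sW f (p + q) = linear_extension sW f p + linear_extension sW f q"
      by (subst (1 2 3) sup[of ?A])
        (use keys_add[of p q] in \<open>auto simp: lookup_add W.scale_left_distrib sum.distrib\<close>)
  next
    fix c and p :: "'b \<Rightarrow>\<^sub>0 'k"
    have "Poly_Mapping.keys (free_scale c p) \<subseteq> Poly_Mapping.keys p"
      by (auto simp: in_keys_iff lookup_free_scale)
    then show "linear_extension sW f (free_scale c p) = sW c (linear_extension sW f p)"
      by (subst (1 2) sup[of "Poly_Mapping.keys p"])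
        (auto simp: lookup_free_scale W.scale_sum_right)
  qed
qed

lemma linear_extension_single:
  assumes "vector_space sW"
  shows "linear_extension sW f (Poly_Mapping.single i 1) = f i"
proof -
  interpret W: vector_space sW by fact
  show ?thesis by (simp add: linear_extension_def)
qed

lemma sweedler_class2_mod:
  fixes scale :: "'k::field \<Rightarrow> 'v::ab_group_add \<Rightarrow> 'v" and sW :: "'k \<Rightarrow> 'w::ab_group_add \<Rightarrow> 'w"
    and f :: "'v \<times> 'v \<Rightarrow> 'w"
  assumes W: "vector_space sW" and U: "module.subspace sW U"
    and "\<And>a a' b. f (a + a', b) - f (a, b) - f (a', b) \<in> U"
    and "\<And>a b b'. f (a, b + b') - f (a, b) - f (a, b') \<in> U"
    and "\<And>c a b. f (scale c a, b) - sW c (f (a, b)) \<in> U"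
    and "\<And>c a b. f (a, scale c b) - sW c (f (a, b)) \<in> U"
  shows "sweedler sW f (class2 scale p) - linear_extension sW f p \<in> U"
proof -
  interpret W: vector_space sW by fact
  interpret F: vector_space "free_scale :: 'k \<Rightarrow> ('v \<times> 'v \<Rightarrow>\<^sub>0 'k) \<Rightarrow> _"
    by (rule vector_space_free_scale)
  interpret E: Vector_Spaces.linear free_scale sW "linear_extension sW f"
    by (rule linear_linear_extension[OF W])
  have sub: "F.subspace {q. linear_extension sW f q \<in> U}"
    using U by (auto simp: F.subspace_def W.subspace_def E.zero E.add E.scale)
  have "rels2 scale \<subseteq> {q. linear_extension sW f q \<in> U}"
    unfolding rels2_def
    by (rule F.span_minimal[OF _ sub])
      (auto simp: pure2_def E.diff E.scale linear_extension_single[OF W] assms(3-6))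
  then have rel: "linear_extension sW f q \<in> U" if "q \<in> rels2 scale" for q
    using that by auto
  have "0 \<in> rels2 scale"
    unfolding rels2_def by (rule F.span_zero)
  then have "p \<in> class2 scale p"
    by (simp add: class2_def)
  then have "(SOME q. q \<in> class2 scale p) \<in> class2 scale p"
    by (rule someI)
  from rel[OF this[unfolded class2_def mem_Collect_eq]] show ?thesis
    by (simp add: sweedler_def class2_def E.diff)
qed

lemma sweedler_class2:
  fixes scale :: "'k::field \<Rightarrow> 'v::ab_group_add \<Rightarrow> 'v" and sW :: "'k \<Rightarrow> 'w::ab_group_add \<Rightarrow> 'w"
    and f :: "'v \<times> 'v \<Rightarrow> 'w"
  assumes W: "vector_space sW"
    and "\<And>a a' b. f (a + a', b) = f (a, b) + f (a', b)"
    and "\<And>a b b'. f (a, b + b') = f (a, b) + f (a, b')"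
    and "\<And>c a b. f (scale c a, b) = sW c (f (a, b))"
    and "\<And>c a b. f (a, scale c b) = sW c (f (a, b))"
  shows "sweedler sW f (class2 scale p) = linear_extension sW f p"
proof -
  interpret W: vector_space sW by fact
  show ?thesis
    using sweedler_class2_mod[OF W W.subspace_single_0, of f scale p] assms(2-5) by simp
qed

definition linear_to_tensor2 ::
    "('k::field \<Rightarrow> 'v::ab_group_add \<Rightarrow> 'v) \<Rightarrow> ('v \<Rightarrow> ('v \<times> 'v \<Rightarrow>\<^sub>0 'k) set) \<Rightarrow> bool"
  where "linear_to_tensor2 scale \<delta> \<longleftrightarrow>
    (\<forall>x. \<delta> x \<in> tensor2 scale) \<and>
    (\<forall>x y. \<forall>p\<in>\<delta> x. \<forall>q\<in>\<delta> y. p + q \<in> \<delta> (x + y)) \<and>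
    (\<forall>c x. \<forall>p\<in>\<delta> x. free_scale c p \<in> \<delta> (scale c x))"

definition bilinear_map ::
    "('k::field \<Rightarrow> 'v::ab_group_add \<Rightarrow> 'v) \<Rightarrow> ('k \<Rightarrow> 'w::ab_group_add \<Rightarrow> 'w) \<Rightarrow> ('v \<Rightarrow> 'v \<Rightarrow> 'w) \<Rightarrow> bool"
  where "bilinear_map scale sW f \<longleftrightarrow>
    (\<forall>x. Vector_Spaces.linear scale sW (\<lambda>y. f x y)) \<and>
    (\<forall>y. Vector_Spaces.linear scale sW (\<lambda>x. f x y))"


section \<open>Leibniz algebras, coalgebras and bialgebras\<close>

definition leibniz_algebra ::
    "('k::field \<Rightarrow> 'v::ab_group_add \<Rightarrow> 'v) \<Rightarrow> ('v \<Rightarrow> 'v \<Rightarrow> 'v) \<Rightarrow> bool"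
  where "leibniz_algebra scale br \<longleftrightarrow>
    vector_space scale \<and> bilinear_map scale scale br \<and>
    (\<forall>x y z. br x (br y z) = br (br x y) z + br y (br x z))"

definition leibniz_coalgebra ::
    "('k::field \<Rightarrow> 'v::ab_group_add \<Rightarrow> 'v) \<Rightarrow> ('v \<Rightarrow> ('v \<times> 'v \<Rightarrow>\<^sub>0 'k) set) \<Rightarrow> bool"
  where "leibniz_coalgebra scale \<delta> \<longleftrightarrow>
    vector_space scale \<and> linear_to_tensor2 scale \<delta> \<and>
    (\<forall>x. class3 scale
           (sweedler free_scale (\<lambda>(x1, x2).
              sweedler free_scale (\<lambda>(x21, x22). pure3 x1 x21 x22) (\<delta> x2)) (\<delta> x))
         = class3 scale
           (sweedler free_scale (\<lambda>(x1, x2).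
              sweedler free_scale (\<lambda>(x11, x12). pure3 x11 x12 x2) (\<delta> x1)) (\<delta> x)
            + sweedler free_scale (\<lambda>(x1, x2).
              sweedler free_scale (\<lambda>(x21, x22). pure3 x21 x1 x22) (\<delta> x2)) (\<delta> x)))"

definition symmetric_tensor ::
    "('k::field \<Rightarrow> 'v::ab_group_add \<Rightarrow> 'v) \<Rightarrow> ('v \<times> 'v \<Rightarrow>\<^sub>0 'k) set \<Rightarrow> bool"
  where "symmetric_tensor scale r \<longleftrightarrow>
    r = class2 scale (sweedler free_scale (\<lambda>(r1, r2). pure2 r2 r1) r)"

definition classical_LYBE ::
    "('k::field \<Rightarrow> 'v::ab_group_add \<Rightarrow> 'v) \<Rightarrow> ('v \<Rightarrow> 'v \<Rightarrow> 'v) \<Rightarrow> ('v \<times> 'v \<Rightarrow>\<^sub>0 'k) set \<Rightarrow> bool"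
  where "classical_LYBE scale br r \<longleftrightarrow>
    class3 scale (sweedler free_scale (\<lambda>(r1, r2). sweedler free_scale (\<lambda>(s1, s2).
        pure3 r1 (br r2 s1) s2 + pure3 r1 s1 (br r2 s2)) r) r)
    = class3 scale (sweedler free_scale (\<lambda>(r1, r2). sweedler free_scale (\<lambda>(s1, s2).
        pure3 (br r2 s1) r1 s2 + pure3 (br r1 s2) s1 r2) r) r)"

definition cobracket_of ::
    "('k::field \<Rightarrow> 'v::ab_group_add \<Rightarrow> 'v) \<Rightarrow> ('v \<Rightarrow> 'v \<Rightarrow> 'v) \<Rightarrow> ('v \<times> 'v \<Rightarrow>\<^sub>0 'k) set \<Rightarrow>
      'v \<Rightarrow> ('v \<times> 'v \<Rightarrow>\<^sub>0 'k) set"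
  where "cobracket_of scale br r x = class2 scale (sweedler free_scale (\<lambda>(r1, r2).
    - pure2 r1 (br r2 x) + pure2 (br r2 x) r1 + pure2 (br x r2) r1) r)"

definition triangular_leibniz_bialgebra ::
    "('k::field \<Rightarrow> 'v::ab_group_add \<Rightarrow> 'v) \<Rightarrow> ('v \<Rightarrow> 'v \<Rightarrow> 'v) \<Rightarrow> ('v \<times> 'v \<Rightarrow>\<^sub>0 'k) set \<Rightarrow>
      ('v \<Rightarrow> ('v \<times> 'v \<Rightarrow>\<^sub>0 'k) set) \<Rightarrow> bool"
  where "triangular_leibniz_bialgebra scale br r \<delta> \<longleftrightarrow>
    leibniz_algebra scale br \<and> r \<in> tensor2 scale \<and> symmetric_tensor scale r \<and>
    classical_LYBE scale br r \<and> \<delta> = cobracket_of scale br r"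

definition symmetric_form :: "('v \<Rightarrow> 'v \<Rightarrow> 'k) \<Rightarrow> bool"
  where "symmetric_form \<omega> \<longleftrightarrow> (\<forall>x y. \<omega> x y = \<omega> y x)"

definition coclassical_LYBE ::
    "('v \<Rightarrow> ('v \<times> 'v \<Rightarrow>\<^sub>0 'k::field) set) \<Rightarrow> ('v \<Rightarrow> 'v \<Rightarrow> 'k) \<Rightarrow> bool"
  where "coclassical_LYBE \<delta> \<omega> \<longleftrightarrow> (\<forall>x y z.
    sweedler (*) (\<lambda>(y1, y2). \<omega> x y1 * \<omega> y2 z) (\<delta> y)
      + sweedler (*) (\<lambda>(z1, z2). \<omega> x z1 * \<omega> y z2) (\<delta> z)
    = sweedler (*) (\<lambda>(x1, x2). \<omega> y x1 * \<omega> x2 z) (\<delta> x)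
      + sweedler (*) (\<lambda>(x1, x2). \<omega> x1 z * \<omega> y x2) (\<delta> x))"

definition bracket_of ::
    "('k::field \<Rightarrow> 'v::ab_group_add \<Rightarrow> 'v) \<Rightarrow> ('v \<Rightarrow> ('v \<times> 'v \<Rightarrow>\<^sub>0 'k) set) \<Rightarrow> ('v \<Rightarrow> 'v \<Rightarrow> 'k) \<Rightarrow>
      'v \<Rightarrow> 'v \<Rightarrow> 'v"
  where "bracket_of scale \<delta> \<omega> x y =
    - sweedler scale (\<lambda>(y1, y2). scale (\<omega> x y1) y2) (\<delta> y)
    + sweedler scale (\<lambda>(x1, x2). scale (\<omega> y x1) x2) (\<delta> x)
    + sweedler scale (\<lambda>(x1, x2). scale (\<omega> y x2) x1) (\<delta> x)"

definition dual_triangular_leibniz_bialgebra ::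
    "('k::field \<Rightarrow> 'v::ab_group_add \<Rightarrow> 'v) \<Rightarrow> ('v \<Rightarrow> ('v \<times> 'v \<Rightarrow>\<^sub>0 'k) set) \<Rightarrow> ('v \<Rightarrow> 'v \<Rightarrow> 'k) \<Rightarrow>
      ('v \<Rightarrow> 'v \<Rightarrow> 'v) \<Rightarrow> bool"
  where "dual_triangular_leibniz_bialgebra scale \<delta> \<omega> br \<longleftrightarrow>
    leibniz_coalgebra scale \<delta> \<and> bilinear_map scale (*) \<omega> \<and> symmetric_form \<omega> \<and>
    coclassical_LYBE \<delta> \<omega> \<and> br = bracket_of scale \<delta> \<omega>"

text \<open>As in the source, a symplectic form is not required to be nondegenerate.\<close>

definition symplectic_leibniz_algebra ::
    "('k::field \<Rightarrow> 'v::ab_group_add \<Rightarrow> 'v) \<Rightarrow> ('v \<Rightarrow> 'v \<Rightarrow> 'v) \<Rightarrow> ('v \<Rightarrow> 'v \<Rightarrow> 'k) \<Rightarrow> bool"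
  where "symplectic_leibniz_algebra scale br \<omega> \<longleftrightarrow>
    leibniz_algebra scale br \<and> bilinear_map scale (*) \<omega> \<and> symmetric_form \<omega> \<and>
    (\<forall>x y z. \<omega> (br x y) z + \<omega> (br x z) y = \<omega> (br y z) x + \<omega> (br z y) x)"

definition nijenhuis_leibniz_algebra ::
    "('k::field \<Rightarrow> 'v::ab_group_add \<Rightarrow> 'v) \<Rightarrow> ('v \<Rightarrow> 'v \<Rightarrow> 'v) \<Rightarrow> ('v \<Rightarrow> 'v) \<Rightarrow> bool"
  where "nijenhuis_leibniz_algebra scale br N \<longleftrightarrow>
    leibniz_algebra scale br \<and> Vector_Spaces.linear scale scale N \<and>
    (\<forall>x y. br (N x) (N y) + N (N (br x y)) = N (br (N x) y) + N (br x (N y)))"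

end

theory Submission
  imports Defs
begin

text \<open>
  The tensor \<open>r\<close> enters only through contractions with \<open>\<omega>\<close>: for every linear \<open>T\<close>, the sum
  \<open>\<omega>(x, r\<^sup>1) T(r\<^sup>2)\<close> equals \<open>T(N x)\<close> (\<open>sweedler_contraction\<close>; \<open>N\<close> is called \<open>contraction\<close> in the
  lemmas). Both Yang-Baxter equations thereby become identities in
  \<open>N\<close>, the bracket and \<open>\<omega>\<close>.

  \<^item> Contracting the first two legs of the classical equation with \<open>\<omega>(x, \<cdot>)\<close> and \<open>\<omega>(y, \<cdot>)\<close> gives
    (\<open>contracted_LYBE\<close>)
    \<open>\<omega>(y, [N x, r\<^sup>1]) r\<^sup>2 + [N x, N y] = \<omega>(x, [N y, r\<^sup>1]) r\<^sup>2 + \<omega>(x, [r\<^sup>1, N y]) r\<^sup>2\<close>.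
    The symplectic identity turns the right-hand side into
    \<open>N [x, N y] + \<omega>([x, r\<^sup>1], N y) r\<^sup>2\<close>.
  \<^item> Inserting \<open>\<delta>\<^sub>r\<close> into the co-classical equation gives twelve terms (\<open>sweedler_cobracket_form\<close>).
    The symplectic identity, applied to the terms where \<open>x\<close> stands alone in \<open>\<omega>\<close>, makes all but four
    cancel (\<open>contracted_coLYBE\<close>):
    \<open>\<omega>([x, z], N y) - \<omega>([N x, z], y) = \<omega>([N x, y], z) - \<omega>([x, y], N z)\<close>.

  Since \<open>r\<close> is symmetric, \<open>N\<close> is self-adjoint for \<open>\<omega>\<close> (\<open>selfadjoint\<close>), so the last term is
  \<open>\<omega>(N [x, y], z)\<close>. Setting \<open>z = r\<^sup>1\<close> and summing against \<open>r\<^sup>2\<close>, the second identity evaluates the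
  terms that remain in the first one to \<open>N [N x, y] - N (N [x, y])\<close>, which is the Nijenhuis
  condition.
\<close>

section \<open>Calculus of Sweedler sums\<close>

lemma vector_space_mult: "vector_space ((*) :: 'k::field \<Rightarrow> 'k \<Rightarrow> 'k)"
  by unfold_locales (simp_all add: algebra_simps)

lemma linear_sweedler:
  assumes "Vector_Spaces.linear sW sX T"
  shows "T (sweedler sW (\<lambda>(a, b). f a b) R) = sweedler sX (\<lambda>(a, b). T (f a b)) R"
proof -
  interpret T: Vector_Spaces.linear sW sX T by fact
  show ?thesis
    by (simp add: sweedler_def linear_extension_def T.sum T.scale case_prod_unfold)
qed

lemma sweedler_add:
  assumes "vector_space sW"
  shows "sweedler sW (\<lambda>(a, b). f a b + g a b) R
    = sweedler sW (\<lambda>(a, b). f a b) R + sweedler sW (\<lambda>(a, b). g a b) R"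
proof -
  interpret W: vector_space sW by fact
  show ?thesis
    by (simp add: sweedler_def linear_extension_def W.scale_right_distrib sum.distrib
        case_prod_unfold)
qed

lemma sweedler_diff:
  assumes "vector_space sW"
  shows "sweedler sW (\<lambda>(a, b). f a b - g a b) R
    = sweedler sW (\<lambda>(a, b). f a b) R - sweedler sW (\<lambda>(a, b). g a b) R"
proof -
  interpret W: vector_space sW by fact
  show ?thesis
    by (simp add: sweedler_def linear_extension_def W.scale_right_diff_distrib sum_subtractf
        case_prod_unfold)
qed

lemma sweedler_minus:
  assumes "vector_space sW"
  shows "sweedler sW (\<lambda>(a, b). - f a b) R = - sweedler sW (\<lambda>(a, b). f a b) R"
proof -
  interpret W: vector_space sW by fact
  show ?thesis
    by (simp add: sweedler_def linear_extension_def sum_negf case_prod_unfold)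
qed

lemma sweedler_scale:
  assumes "vector_space sW"
  shows "sweedler sW (\<lambda>(a, b). sW c (f a b)) R = sW c (sweedler sW (\<lambda>(a, b). f a b) R)"
proof -
  interpret W: vector_space sW by fact
  show ?thesis
    by (simp add: sweedler_def linear_extension_def W.scale_sum_right mult.commute
        case_prod_unfold)
qed

text \<open>
  This is how an equation in \<open>L \<otimes> L \<otimes> L\<close> is put to use: a trilinear map, extended to the free
  space, kills the multilinearity relations and hence depends on the class only.
\<close>

lemma linear_extension_cong_class3:
  fixes scale :: "'k::field \<Rightarrow> 'v::ab_group_add \<Rightarrow> 'v" and sW :: "'k \<Rightarrow> 'w::ab_group_add \<Rightarrow> 'w"
  assumes W: "vector_space sW"
    and "\<And>u u' v w. f (u + u', v, w) = f (u, v, w) + f (u', v, w)"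
    and "\<And>u v v' w. f (u, v + v', w) = f (u, v, w) + f (u, v', w)"
    and "\<And>u v w w'. f (u, v, w + w') = f (u, v, w) + f (u, v, w')"
    and "\<And>c u v w. f (scale c u, v, w) = sW c (f (u, v, w))"
    and "\<And>c u v w. f (u, scale c v, w) = sW c (f (u, v, w))"
    and "\<And>c u v w. f (u, v, scale c w) = sW c (f (u, v, w))"
    and eq: "class3 scale p = class3 scale q"
  shows "linear_extension sW f p = linear_extension sW f q"
proof -
  interpret F: vector_space "free_scale :: 'k \<Rightarrow> ('v \<times> 'v \<times> 'v \<Rightarrow>\<^sub>0 'k) \<Rightarrow> _"
    by (rule vector_space_free_scale)
  interpret E: Vector_Spaces.linear free_scale sW "linear_extension sW f"
    by (rule linear_linear_extension[OF W])
  have sub: "F.subspace {s. linear_extension sW f s = 0}"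
    by (auto simp: F.subspace_def E.zero E.add E.scale)
  have "rels3 scale \<subseteq> {s. linear_extension sW f s = 0}"
    unfolding rels3_def
    by (rule F.span_minimal[OF _ sub])
      (auto simp: pure3_def E.diff E.scale linear_extension_single[OF W] assms(2-7))
  moreover have "p \<in> class3 scale p"
    by (simp add: class3_def rels3_def F.span_zero)
  then have "p - q \<in> rels3 scale"
    by (simp add: eq) (simp add: class3_def)
  ultimately have "linear_extension sW f (p - q) = 0"
    by blast
  then show ?thesis
    by (simp add: E.diff)
qed

section \<open>Contraction of a tensor with a symmetric form\<close>

locale algebra_with_form =
  fixes scale :: "'k::field \<Rightarrow> 'v::ab_group_add \<Rightarrow> 'v"
    and br :: "'v \<Rightarrow> 'v \<Rightarrow> 'v"
    and \<omega> :: "'v \<Rightarrow> 'v \<Rightarrow> 'k"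
    and r :: "('v \<times> 'v \<Rightarrow>\<^sub>0 'k) set"
  assumes bilinear_br: "bilinear_map scale scale br"
    and bilinear_form: "bilinear_map scale (*) \<omega>"
    and form_sym: "\<omega> x y = \<omega> y x"
begin

lemma vector_space_scale: "vector_space scale"
  using bilinear_br by (auto simp: bilinear_map_def Vector_Spaces.linear_iff)

sublocale V: vector_space scale
  by (rule vector_space_scale)

lemma br_simps:
  "br (x + y) z = br x z + br y z" "br x (y + z) = br x y + br x z"
  "br (scale c x) y = scale c (br x y)" "br x (scale c y) = scale c (br x y)"
  using bilinear_br by (auto simp: bilinear_map_def Vector_Spaces.linear_iff)

lemma form_simps:
  "\<omega> (x + y) z = \<omega> x z + \<omega> y z" "\<omega> x (y + z) = \<omega> x y + \<omega> x z"
  "\<omega> (scale c x) y = c * \<omega> x y" "\<omega> x (scale c y) = c * \<omega> x y"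
  using bilinear_form by (auto simp: bilinear_map_def Vector_Spaces.linear_iff)

lemma weighted_sum_simps:
  "sweedler scale (\<lambda>(a, b). scale (f a + g a) b) r
    = sweedler scale (\<lambda>(a, b). scale (f a) b) r + sweedler scale (\<lambda>(a, b). scale (g a) b) r"
  "sweedler scale (\<lambda>(a, b). scale (f a - g a) b) r
    = sweedler scale (\<lambda>(a, b). scale (f a) b) r - sweedler scale (\<lambda>(a, b). scale (g a) b) r"
  "sweedler scale (\<lambda>(a, b). scale (c * f a) b) r
    = scale c (sweedler scale (\<lambda>(a, b). scale (f a) b) r)"
  "sweedler scale (\<lambda>(a, b). scale (f a * c) b) r
    = scale c (sweedler scale (\<lambda>(a, b). scale (f a) b) r)"
  by (simp_all add: V.scale_left_distrib V.scale_left_diff_distrib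
      sweedler_add[OF vector_space_scale] sweedler_diff[OF vector_space_scale]
      sweedler_scale[OF vector_space_scale, symmetric] mult.commute[of _ c])

definition contraction :: "'v \<Rightarrow> 'v"
  where "contraction x = sweedler scale (\<lambda>(a, b). scale (\<omega> x a) b) r"

text \<open>
  Linearity lets \<open>T\<close> leave the sum. Every sum over \<open>r\<close> in the two Yang-Baxter equations that can be
  eliminated is eliminated in this way.
\<close>

lemma sweedler_contraction:
  assumes T: "Vector_Spaces.linear scale sW T"
  shows "sweedler sW (\<lambda>(a, b). sW (\<omega> x a) (T b)) r = T (contraction x)"
proof -
  interpret T: Vector_Spaces.linear scale sW T by fact
  show ?thesis
    by (simp add: contraction_def linear_sweedler[OF T] T.scale)
qed

lemma linear_contraction: "Vector_Spaces.linear scale scale contraction"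
  by (simp add: Vector_Spaces.linear_iff vector_space_scale contraction_def form_simps
      weighted_sum_simps)

text \<open>
  Both sides are values of \<open>\<omega>(x, \<cdot>) \<otimes> \<omega>(y, \<cdot>)\<close>, one on \<open>r\<close> and the other on its
  flip, and symmetry identifies \<open>r\<close> with its flip.
\<close>

lemma selfadjoint:
  assumes sym: "symmetric_tensor scale r"
  shows "\<omega> (contraction x) y = \<omega> x (contraction y)"
proof -
  let ?F = "\<lambda>(a, b). \<omega> x a * \<omega> y b"
  let ?E = "linear_extension (*) ?F"
  have "\<omega> (contraction x) y = \<omega> y (contraction x)"
    by (rule form_sym)
  also have "\<dots> = sweedler (*) ?F r"
    by (rule sweedler_contraction[symmetric])
      (simp add: Vector_Spaces.linear_iff vector_space_scale vector_space_mult form_simps)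
  also have "\<dots> = sweedler (*) ?F (class2 scale (sweedler free_scale (\<lambda>(a, b). pure2 b a) r))"
    using sym by (simp add: symmetric_tensor_def)
  also have "\<dots> = ?E (sweedler free_scale (\<lambda>(a, b). pure2 b a) r)"
    by (rule sweedler_class2[OF vector_space_mult]) (simp_all add: form_simps algebra_simps)
  also have "\<dots> = sweedler (*) (\<lambda>(a, b). \<omega> y a * \<omega> x b) r"
    by (simp add: linear_sweedler[OF linear_linear_extension[OF vector_space_mult]]
        pure2_def linear_extension_single[OF vector_space_mult] mult.commute)
  also have "\<dots> = \<omega> x (contraction y)"
    by (rule sweedler_contraction)
      (simp add: Vector_Spaces.linear_iff vector_space_scale vector_space_mult form_simps)
  finally show ?thesis .
qed

section \<open>The two Yang-Baxter equations in contracted form\<close>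

lemma sweedler_br_left_linear:
  "Vector_Spaces.linear scale scale
    (\<lambda>b. sweedler scale (\<lambda>(a', b'). scale (\<omega> y (br b a')) b') r)"
  by (simp add: Vector_Spaces.linear_iff vector_space_scale br_simps form_simps
      weighted_sum_simps)

text \<open>
  Here \<open>\<omega>(x, \<cdot>) \<otimes> \<omega>(y, \<cdot>) \<otimes> id\<close> is applied to the classical equation. Each of the four summands
  has a leg that is a bare factor of \<open>r\<close>, paired with \<open>x\<close> or \<open>y\<close>, and summing over that
  copy of \<open>r\<close> leaves \<open>N x\<close> or \<open>N y\<close> inside the bracket. The second summand has two such legs.
\<close>

lemma contracted_LYBE:
  assumes "classical_LYBE scale br r"
  shows "sweedler scale (\<lambda>(a, b). scale (\<omega> y (br (contraction x) a)) b) r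
      + br (contraction x) (contraction y)
    = sweedler scale (\<lambda>(a, b). scale (\<omega> x (br (contraction y) a)) b) r
      + sweedler scale (\<lambda>(a, b). scale (\<omega> x (br a (contraction y))) b) r"
    (is "?A + ?B = ?C + ?D")
proof -
  let ?F = "\<lambda>(u, v, w). scale (\<omega> x u * \<omega> y v) w"
  let ?E = "linear_extension scale ?F"
  have lin: "Vector_Spaces.linear free_scale scale ?E"
    by (rule linear_linear_extension[OF vector_space_scale])
  interpret E: Vector_Spaces.linear free_scale scale ?E by (rule lin)
  have pure: "?E (pure3 u v w) = scale (\<omega> x u * \<omega> y v) w" for u v w
    by (simp add: pure3_def linear_extension_single[OF vector_space_scale])
  note push = linear_sweedler[OF lin] E.add pure sweedler_add[OF vector_space_scale]
  have br_lin: "Vector_Spaces.linear scale scale (\<lambda>b. br b z)"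
    "Vector_Spaces.linear scale scale (br z)" for z
    by (simp_all add: Vector_Spaces.linear_iff vector_space_scale br_simps)
  have eq: "?E (sweedler free_scale (\<lambda>(r1, r2). sweedler free_scale (\<lambda>(s1, s2).
        pure3 r1 (br r2 s1) s2 + pure3 r1 s1 (br r2 s2)) r) r)
    = ?E (sweedler free_scale (\<lambda>(r1, r2). sweedler free_scale (\<lambda>(s1, s2).
        pure3 (br r2 s1) r1 s2 + pure3 (br r1 s2) s1 r2) r) r)"
    by (rule linear_extension_cong_class3[OF vector_space_scale _ _ _ _ _ _
          assms[unfolded classical_LYBE_def]])
      (simp_all add: form_simps algebra_simps V.scale_left_distrib V.scale_right_distrib)
  \<comment> \<open>In \<open>A\<close> and \<open>C\<close> it is the outer copy of \<open>r\<close> that collapses, in \<open>D\<close> the inner one,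
    and in \<open>B\<close> both.\<close>
  have A: "sweedler scale (\<lambda>(r1, r2). sweedler scale (\<lambda>(s1, s2).
      scale (\<omega> x r1 * \<omega> y (br r2 s1)) s2) r) r = ?A"
    unfolding weighted_sum_simps by (rule sweedler_contraction[OF sweedler_br_left_linear])
  have C: "sweedler scale (\<lambda>(r1, r2). sweedler scale (\<lambda>(s1, s2).
      scale (\<omega> x (br r2 s1) * \<omega> y r1) s2) r) r = ?C"
    unfolding weighted_sum_simps by (rule sweedler_contraction[OF sweedler_br_left_linear])
  have inner: "sweedler scale (\<lambda>(s1, s2). scale (\<omega> y s1 * c) (T s2)) r
      = scale c (T (contraction y))"
    if T: "Vector_Spaces.linear scale scale T" for c T
  proof -
    interpret T: Vector_Spaces.linear scale scale T by (rule T)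
    have "Vector_Spaces.linear scale scale (\<lambda>b. scale c (T b))"
      by (simp add: Vector_Spaces.linear_iff vector_space_scale T.add T.scale
          V.scale_right_distrib mult.commute)
    from sweedler_contraction[OF this, of y] show ?thesis
      by simp
  qed
  have B: "sweedler scale (\<lambda>(r1, r2). sweedler scale (\<lambda>(s1, s2).
      scale (\<omega> x r1 * \<omega> y s1) (br r2 s2)) r) r = ?B"
    unfolding mult.commute[of "\<omega> x _"] inner[OF br_lin(2)]
    by (rule sweedler_contraction[OF br_lin(1)])
  have "Vector_Spaces.linear scale scale (\<lambda>b. scale (\<omega> x (br r1 b)) r2)" for r1 r2
    by (simp add: Vector_Spaces.linear_iff vector_space_scale br_simps form_simps
        V.scale_left_distrib)
  from sweedler_contraction[OF this, of y]
  have D: "sweedler scale (\<lambda>(r1, r2). sweedler scale (\<lambda>(s1, s2).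
      scale (\<omega> x (br r1 s2) * \<omega> y s1) r2) r) r = ?D"
    by (simp add: mult.commute)
  show ?thesis
    using eq unfolding push A B C D .
qed

lemma sweedler_cobracket_form:
  "sweedler (*) (\<lambda>(u, v). \<omega> p u * \<omega> q v) (cobracket_of scale br r y)
    = - \<omega> q (br (contraction p) y) + \<omega> p (br (contraction q) y) + \<omega> p (br y (contraction q))"
proof -
  let ?F = "\<lambda>(u, v). \<omega> p u * \<omega> q v"
  let ?E = "linear_extension (*) ?F"
  have lin: "Vector_Spaces.linear free_scale (*) ?E"
    by (rule linear_linear_extension[OF vector_space_mult])
  have pure: "?E (pure2 u v) = \<omega> p u * \<omega> q v" for u v
    by (simp add: pure2_def linear_extension_single[OF vector_space_mult])
  have form_lin: "Vector_Spaces.linear scale (*) (\<lambda>b. \<omega> z (br b y))"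
    "Vector_Spaces.linear scale (*) (\<lambda>b. \<omega> z (br y b))" for z
    by (simp_all add: Vector_Spaces.linear_iff vector_space_scale vector_space_mult
        br_simps form_simps)
  have expand: "sweedler (*) ?F (cobracket_of scale br r y) = ?E (sweedler free_scale (\<lambda>(a, b).
      - pure2 a (br b y) + pure2 (br b y) a + pure2 (br y b) a) r)"
    unfolding cobracket_of_def
    by (rule sweedler_class2[OF vector_space_mult]) (simp_all add: form_simps algebra_simps)
  interpret E: Vector_Spaces.linear free_scale "(*)" ?E by (rule lin)
  have push: "?E (sweedler free_scale (\<lambda>(a, b).
      - pure2 a (br b y) + pure2 (br b y) a + pure2 (br y b) a) r)
    = - sweedler (*) (\<lambda>(a, b). \<omega> p a * \<omega> q (br b y)) r
      + sweedler (*) (\<lambda>(a, b). \<omega> q a * \<omega> p (br b y)) r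
      + sweedler (*) (\<lambda>(a, b). \<omega> q a * \<omega> p (br y b)) r"
    unfolding linear_sweedler[OF lin] E.add E.neg pure
      sweedler_add[OF vector_space_mult] sweedler_minus[OF vector_space_mult]
    by (simp only: mult.commute)
  show ?thesis
    unfolding expand push
    by (simp add: sweedler_contraction[OF form_lin(1)] sweedler_contraction[OF form_lin(2)])
qed

text \<open>
  On the right of the co-classical equation, four of the six terms cancel in pairs by the symmetry
  of \<open>\<omega>\<close>. On the left, the symplectic identity rewrites the two pairs
  \<open>\<omega>([y, N z] + [N z, y], x)\<close> and \<open>\<omega>([z, N y] + [N y, z], x)\<close>, and this produces the remaining
  two terms of the right-hand side, so that these cancel as well.
\<close>

lemma contracted_coLYBE:
  assumes coLYBE: "coclassical_LYBE (cobracket_of scale br r) \<omega>"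
    and sympl: "\<And>x y z. \<omega> (br x y) z + \<omega> (br x z) y = \<omega> (br y z) x + \<omega> (br z y) x"
  shows "\<omega> (br x z) (contraction y) - \<omega> (br (contraction x) z) y
    = \<omega> (br (contraction x) y) z - \<omega> (br x y) (contraction z)"
proof -
  let ?\<delta> = "cobracket_of scale br r" and ?N = contraction
  have "sweedler (*) (\<lambda>(u, v). \<omega> x u * \<omega> z v) (?\<delta> y)
      + sweedler (*) (\<lambda>(u, v). \<omega> x u * \<omega> y v) (?\<delta> z)
    = sweedler (*) (\<lambda>(u, v). \<omega> y u * \<omega> z v) (?\<delta> x)
      + sweedler (*) (\<lambda>(u, v). \<omega> z u * \<omega> y v) (?\<delta> x)"
    using coLYBE[unfolded coclassical_LYBE_def, rule_format, of x z y]
    unfolding form_sym[of _ z] .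
  then have "(\<omega> (br y (?N z)) x + \<omega> (br (?N z) y) x)
      + (\<omega> (br z (?N y)) x + \<omega> (br (?N y) z) x)
      - \<omega> (br (?N x) y) z - \<omega> (br (?N x) z) y
    = \<omega> (br x (?N z)) y + \<omega> (br x (?N y)) z"
    unfolding sweedler_cobracket_form by (simp add: form_sym algebra_simps)
  then show ?thesis
    unfolding sympl[of x y "?N z", symmetric] sympl[of x z "?N y", symmetric]
    by (simp add: algebra_simps)
qed

section \<open>The Nijenhuis condition\<close>

lemma nijenhuis_contraction:
  assumes sym: "symmetric_tensor scale r"
    and LYBE: "classical_LYBE scale br r"
    and coLYBE: "coclassical_LYBE (cobracket_of scale br r) \<omega>"
    and sympl: "\<And>x y z. \<omega> (br x y) z + \<omega> (br x z) y = \<omega> (br y z) x + \<omega> (br z y) x"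
  shows "br (contraction x) (contraction y) + contraction (contraction (br x y))
    = contraction (br (contraction x) y) + contraction (br x (contraction y))"
proof -
  let ?N = contraction
  let ?S = "\<lambda>f. sweedler scale (\<lambda>(a, b). scale (f a) b) r"
  \<comment> \<open>The right-hand side of the contracted classical equation, rewritten by the symplectic
    identity for \<open>x\<close>, \<open>N y\<close> and the first leg of \<open>r\<close>.\<close>
  have "?S (\<lambda>a. \<omega> x (br (?N y) a) + \<omega> x (br a (?N y)))
      = ?S (\<lambda>a. \<omega> (br x (?N y)) a + \<omega> (br x a) (?N y))"
    using sympl[of x "?N y"] by (simp add: form_sym[of x])
  then have symp: "?S (\<lambda>a. \<omega> x (br (?N y) a)) + ?S (\<lambda>a. \<omega> x (br a (?N y)))
      = ?N (br x (?N y)) + ?S (\<lambda>a. \<omega> (br x a) (?N y))"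
    by (simp add: weighted_sum_simps contraction_def[of "br x (?N y)"])
  have "\<omega> (br x a) (?N y) - \<omega> y (br (?N x) a) = \<omega> (br (?N x) y) a - \<omega> (?N (br x y)) a" for a
    using contracted_coLYBE[OF coLYBE sympl, of x a y] selfadjoint[OF sym, of "br x y" a]
    by (simp add: form_sym[of y])
  then have "?S (\<lambda>a. \<omega> (br x a) (?N y) - \<omega> y (br (?N x) a))
      = ?S (\<lambda>a. \<omega> (br (?N x) y) a - \<omega> (?N (br x y)) a)"
    by simp
  then have rest: "?S (\<lambda>a. \<omega> (br x a) (?N y)) - ?S (\<lambda>a. \<omega> y (br (?N x) a))
      = ?N (br (?N x) y) - ?N (?N (br x y))"
    by (simp add: weighted_sum_simps contraction_def[of "br (?N x) y"]
        contraction_def[of "?N (br x y)"])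
  have "br (?N x) (?N y)
      = ?N (br x (?N y)) + (?S (\<lambda>a. \<omega> (br x a) (?N y)) - ?S (\<lambda>a. \<omega> y (br (?N x) a)))"
    using trans[OF contracted_LYBE[OF LYBE] symp]
    by (simp only: add_diff_eq eq_diff_eq add.commute)
  then show ?thesis
    by (simp add: rest)
qed

end

theorem theorem3p10:
  fixes scale :: "'k::field \<Rightarrow> 'v::ab_group_add \<Rightarrow> 'v"
    and br :: "'v \<Rightarrow> 'v \<Rightarrow> 'v"
    and \<omega> :: "'v \<Rightarrow> 'v \<Rightarrow> 'k"
    and r :: "('v \<times> 'v \<Rightarrow>\<^sub>0 'k) set"
    and N :: "'v \<Rightarrow> 'v"
  assumes "symplectic_leibniz_algebra scale br \<omega>"
    and "r \<in> tensor2 scale"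
    and "triangular_leibniz_bialgebra scale br r (cobracket_of scale br r)"
    and "dual_triangular_leibniz_bialgebra scale (cobracket_of scale br r) \<omega>
           (bracket_of scale (cobracket_of scale br r) \<omega>)"
    and "\<And>x. N x = sweedler scale (\<lambda>(r1, r2). scale (\<omega> x r1) r2) r"
  shows "nijenhuis_leibniz_algebra scale br N"
proof -
  have alg: "leibniz_algebra scale br"
    using assms(1) by (simp add: symplectic_leibniz_algebra_def)
  interpret algebra_with_form scale br \<omega> r
    using assms(1) by unfold_locales
      (auto simp: symplectic_leibniz_algebra_def leibniz_algebra_def symmetric_form_def)
  have N: "N = contraction"
    by (simp add: fun_eq_iff assms(5) contraction_def)
  have "br (contraction x) (contraction y) + contraction (contraction (br x y))
    = contraction (br (contraction x) y) + contraction (br x (contraction y))" for x y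
    by (rule nijenhuis_contraction)
      (use assms(1-4) in \<open>auto simp: symplectic_leibniz_algebra_def
          triangular_leibniz_bialgebra_def dual_triangular_leibniz_bialgebra_def\<close>)
  then show ?thesis
    by (simp add: nijenhuis_leibniz_algebra_def alg N linear_contraction)
qed

end
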